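(* Let $B=F(b_1,\ldots,b_n)$ be a Ferrers board with $0\le b_1\le\cdots\le b_n$ and $b_n>0$, and let $x$ be an integer with $x\ge b_n$. Then $$[x]_q^n=\sum_{k=0}^n\mathbf{RT}_{n-k}(B,q)\,[x-F_{b_1}]_q[x-F_{b_2}]_q\cdots[x-F_{b_k}]_q.$$
   Context: Fibonacci numbers: $F_0=0$, $F_1=1$, $F_m=F_{m-1}+F_{m-2}$. For any integer $m$, $[m]_q=\frac{1-q^m}{1-q}$ (a rational function of $q$; $[0]_q=0$). For $m\ge1$, $\mathcal{F}_m$ is the set of tilings of a column of height $m$ (levels $1,\dots,m$ from the bottom) by tiles of heights 1 and 2 whose bottom-most tile has height 1; $\mathcal{F}_0=\emptyset$. For $T\in\mathcal{F}_m$, $\mathrm{rank}_m(T)=\sum F_{i-1}$, the sum over all $i$ such that $T$ has a tile of height 2 occupying levels $i-1$ and $i$. A Ferrers board $F(b_1,\dots,b_n)$ has columns $1,\dots,n$ of heights $b_1\le\cdots\le b_n$. For $0\le k\le n$, $\mathcal{NT}_k(B)$ is the set of Fibonacci rook placements with $k$ tilings: a sequence of columns $1\le i_1<\cdots<i_k\le n$ together with, for each $s=1,\dots,k$, a tiling $T_{i_s}\in\mathcal{F}_{e_s}$ where $e_s=b_{i_s-s+1}$ (geometrically, each tiling cancels top cells of the columns to its right so that after $s$ tilings the untiled columns have $b_1,\dots,b_{n-s}$ uncanceled cells from left to right). For $k=0$ only the empty placement exists. For such $P$, $W_{B,q}(P)=q^{\sum_{s=1}^k\mathrm{rank}_{e_s}(T_{i_s})+\sum_{t=1}^{n-k}F_{b_t}}$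 and $\mathbf{RT}_k(B,q)=\sum_{P\in\mathcal{NT}_k(B)}W_{B,q}(P)$. An empty product equals 1. *)

theory Defs
  imports
    "HOL-Number_Theory.Fib"
    "HOL-Computational_Algebra.Polynomial"
    "HOL-Computational_Algebra.Fraction_Field"
begin

text \<open>Identities in \<open>q\<close> are identities in the field \<open>\<rat>(q)\<close> of rational functions.\<close>

definition q_var :: "rat poly fract" where
  "q_var = Fract [:0, 1:] 1"

definition q_int :: "int \<Rightarrow> rat poly fract" where
  "q_int m = (1 - q_var powi m) / (1 - q_var)"

text \<open>
  A tiling of a column is the list of the heights of its tiles from bottom to top.
  For \<open>m = 0\<close> the conditions \<open>T \<noteq> []\<close> and \<open>sum_list T = 0\<close> are contradictory, so there
  is no tiling of height 0.
\<close>

definition fib_tilings :: "nat \<Rightarrow> nat list set" where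
  "fib_tilings m = {T. set T \<subseteq> {1, 2} \<and> sum_list T = m \<and> T \<noteq> [] \<and> hd T = 1}"

definition tile_levels :: "nat list \<Rightarrow> nat \<Rightarrow> nat set" where
  "tile_levels T j = {sum_list (take j T) + 1 .. sum_list (take (Suc j) T)}"

definition tiling_rank :: "nat list \<Rightarrow> nat" where
  "tiling_rank T =
     (\<Sum>i | \<exists>j<length T. T ! j = 2 \<and> tile_levels T j = {i - 1, i}. fib (i - 1))"

definition ferrers_board :: "nat \<Rightarrow> (nat \<Rightarrow> nat) \<Rightarrow> bool" where
  "ferrers_board n b \<longleftrightarrow> (\<forall>i j. 1 \<le> i \<and> i \<le> j \<and> j \<le> n \<longrightarrow> b i \<le> b j)"

text \<open>
  A placement is the list of pairs \<open>(i\<^sub>s, T\<^sub>s)\<close> of tiled columns and their tilings. The index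
  \<open>s\<close> in the next three definitions counts from 1.
\<close>

definition column_of :: "(nat \<times> nat list) list \<Rightarrow> nat \<Rightarrow> nat" where
  "column_of P s = fst (P ! (s - 1))"

definition tiling_of :: "(nat \<times> nat list) list \<Rightarrow> nat \<Rightarrow> nat list" where
  "tiling_of P s = snd (P ! (s - 1))"

text \<open>
  The number of uncancelled cells in the \<open>s\<close>-th tiled column. The subtraction does not
  truncate, since \<open>i\<^sub>s \<ge> s\<close> in every placement.
\<close>

definition uncancelled :: "(nat \<Rightarrow> nat) \<Rightarrow> (nat \<times> nat list) list \<Rightarrow> nat \<Rightarrow> nat" where
  "uncancelled b P s = b (column_of P s - s + 1)"

definition placements :: "nat \<Rightarrow> (nat \<Rightarrow> nat) \<Rightarrow> nat \<Rightarrow> (nat \<times> nat list) list set" where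
  "placements n b k =
     {P. length P = k \<and> sorted_wrt (<) (map fst P) \<and> set (map fst P) \<subseteq> {1..n} \<and>
         (\<forall>s\<in>{1..k}. tiling_of P s \<in> fib_tilings (uncancelled b P s))}"

definition placement_weight ::
    "nat \<Rightarrow> (nat \<Rightarrow> nat) \<Rightarrow> (nat \<times> nat list) list \<Rightarrow> rat poly fract" where
  "placement_weight n b P =
     q_var ^ ((\<Sum>s=1..length P. tiling_rank (tiling_of P s)) + (\<Sum>t=1..n - length P. fib (b t)))"

definition RT :: "nat \<Rightarrow> (nat \<Rightarrow> nat) \<Rightarrow> nat \<Rightarrow> rat poly fract" where
  "RT n b k = (\<Sum>P\<in>placements n b k. placement_weight n b P)"

lemma finite_fib_tilings: "finite (fib_tilings m)"
proof -
  have len: "set T \<subseteq> {1, 2} \<Longrightarrow> length T \<le> sum_list T" for T :: "nat list"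
    by (induction T) auto
  have "fib_tilings m \<subseteq> {T. set T \<subseteq> {1, 2} \<and> length T \<le> m}"
    using len by (auto simp: fib_tilings_def)
  then show ?thesis
    using finite_lists_length_le[of "{1, 2 :: nat}" m] finite_subset by auto
qed

lemma finite_placements: "finite (placements n b k)"
proof -
  let ?C = "{1..n} \<times> (\<Union>j\<le>n + 1. fib_tilings (b j))"
  have "placements n b k \<subseteq> {P. set P \<subseteq> ?C \<and> length P = k}"
  proof
    fix P assume P: "P \<in> placements n b k"
    have "P ! s \<in> ?C" if s: "s < length P" for s
    proof -
      have col: "fst (P ! s) \<in> {1..n}"
        using P nth_mem[OF s] by (force simp: placements_def)
      have "tiling_of P (Suc s) \<in> fib_tilings (uncancelled b P (Suc s))"
        using P s by (auto simp: placements_def)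
      then have "snd (P ! s) \<in> fib_tilings (b (fst (P ! s) - Suc s + 1))"
        by (simp add: tiling_of_def uncancelled_def column_of_def)
      moreover have "fst (P ! s) - Suc s + 1 \<le> n + 1"
        using col by auto
      ultimately show ?thesis
        using col by (cases "P ! s") auto
    qed
    then have "set P \<subseteq> ?C"
      by (metis in_set_conv_nth subsetI)
    then show "P \<in> {P. set P \<subseteq> ?C \<and> length P = k}"
      using P by (simp add: placements_def)
  qed
  moreover have "finite ?C"
    using finite_fib_tilings by auto
  ultimately show ?thesis
    using finite_lists_length_eq finite_subset by blast
qed

end

theory Submission
  imports Defs
begin

text \<open>
  The ranks of the tilings in \<open>fib_tilings m\<close> have generating function \<open>[F(m)]\<^sub>q\<close>: removing the
  top tile gives the recurrence \<open>[F(m+2)]\<^sub>q = [F(m+1)]\<^sub>q + q ^ F(m+1) * [F(m)]\<^sub>q\<close>. Distinguishing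
  whether the last column is tiled then yields a two-term recurrence for \<open>RT\<close> in \<open>n\<close>, and the
  product formula follows by induction on \<open>n\<close>, applying \<open>[x]\<^sub>q = [c]\<^sub>q + q ^ c * [x - c]\<^sub>q\<close> with
  \<open>c = F(b (k+1))\<close> to the \<open>k\<close>-th summand.
\<close>

section \<open>q-integers as rational functions\<close>

lemma q_var_nonzero: "q_var \<noteq> 0"
  by (simp add: q_var_def Zero_fract_def eq_fract)

lemma q_var_neq_one: "q_var \<noteq> 1"
  by (simp add: q_var_def One_fract_def eq_fract one_pCons)

lemma q_int_0 [simp]: "q_int 0 = 0"
  by (simp add: q_int_def)

lemma q_int_1 [simp]: "q_int 1 = 1"
  using q_var_neq_one by (simp add: q_int_def)

text \<open>Here \<open>y\<close> may be negative, as \<open>x - c\<close> can be below zero;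
  splitting the power then relies on \<open>q_var\<close> being invertible.\<close>

lemma q_int_add: "q_int (int c + y) = q_int (int c) + q_var ^ c * q_int y"
proof -
  have "1 - q_var \<noteq> 0"
    using q_var_neq_one by simp
  then show ?thesis
    by (simp add: q_int_def power_int_add q_var_nonzero field_simps)
qed

section \<open>Fibonacci tilings and their rank generating function\<close>

lemma fib_tilings_0: "fib_tilings 0 = {}"
proof -
  have "sum_list T \<noteq> 0" if "T \<noteq> []" "hd T = 1" for T :: "nat list"
    using that by (cases T) auto
  then show ?thesis
    by (auto simp: fib_tilings_def)
qed

lemma fib_tilings_1: "fib_tilings (Suc 0) = {[1]}"
proof -
  have "T = [1]" if "set T \<subseteq> {1, 2}" "sum_list T = Suc 0" "T \<noteq> []" "hd T = 1" for T :: "nat list"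
  proof (cases T)
    case (Cons t U)
    then show ?thesis
      using that by (cases U) auto
  qed (use that in simp)
  then show ?thesis
    by (auto simp: fib_tilings_def)
qed

lemma fib_tilings_Suc_Suc:
  "fib_tilings (Suc (Suc m)) =
     (\<lambda>T. T @ [1]) ` fib_tilings (Suc m) \<union> (\<lambda>T. T @ [2]) ` fib_tilings m" (is "_ = ?R")
proof (intro equalityI subsetI)
  fix T assume T: "T \<in> fib_tilings (Suc (Suc m))"
  then obtain U t where U: "T = U @ [t]"
    by (auto simp: fib_tilings_def intro: rev_exhaust)
  \<comment> \<open>A tiling with only one tile has height 1 because its bottom tile does, and here
    the height is at least 2.\<close>
  with T have "U \<noteq> []"
    by (auto simp: fib_tilings_def)
  with T U have "U \<in> fib_tilings (Suc m) \<and> t = 1 \<or> U \<in> fib_tilings m \<and> t = 2"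
    by (auto simp: fib_tilings_def)
  with U show "T \<in> ?R"
    by auto
qed (auto simp: fib_tilings_def)

text \<open>Top levels read off from prefix sums behave well under appending a tile, unlike the set
  equation in \<open>tiling_rank\<close>.\<close>

definition domino_tops :: "nat list \<Rightarrow> nat set" where
  "domino_tops T = {sum_list (take j T) + 2 |j. j < length T \<and> T ! j = 2}"

lemma tiling_rank_eq: "tiling_rank T = (\<Sum>i\<in>domino_tops T. fib (i - 1))"
proof -
  have levels: "tile_levels T j = {i - 1, i} \<longleftrightarrow> i = sum_list (take j T) + 2"
    if "j < length T" "T ! j = 2" for i j
  proof -
    have "tile_levels T j = {sum_list (take j T) + 1, sum_list (take j T) + 2}"
      using that by (auto simp: tile_levels_def take_Suc_conv_app_nth)
    \<comment> \<open>The crossed matching \<open>i = s + 1\<close>, \<open>i - 1 = s + 2\<close>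
      cannot occur, even with truncated subtraction.\<close>
    moreover have "{s + 1, s + 2} = {i - 1, i} \<longleftrightarrow> i = s + 2" for s :: nat
      unfolding doubleton_eq_iff by arith
    ultimately show ?thesis
      by metis
  qed
  have "{i. \<exists>j<length T. T ! j = 2 \<and> tile_levels T j = {i - 1, i}} = domino_tops T"
    unfolding domino_tops_def using levels by blast
  then show ?thesis
    by (simp add: tiling_rank_def)
qed

lemma domino_tops_append:
  "domino_tops (T @ [t]) = domino_tops T \<union> (if t = 2 then {sum_list T + 2} else {})"
proof -
  have "domino_tops (T @ [t]) =
      {sum_list (take j (T @ [t])) + 2 |j. j < length T \<and> (T @ [t]) ! j = 2} \<union>
      (if t = 2 then {sum_list T + 2} else {})"
    by (auto simp: domino_tops_def less_Suc_eq intro: exI[of _ "length T"])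
  also have "{sum_list (take j (T @ [t])) + 2 |j. j < length T \<and> (T @ [t]) ! j = 2} = domino_tops T"
    unfolding domino_tops_def by (intro Collect_cong ex_cong1) (auto simp: nth_append)
  finally show ?thesis .
qed

text \<open>This bound gives finiteness of the set and shows that a domino added on top has a new
  top level, so it contributes exactly one further summand to the rank.\<close>

lemma domino_tops_le: "i \<in> domino_tops T \<Longrightarrow> i \<le> sum_list T"
proof (induction T rule: rev_induct)
  case Nil
  then show ?case by (simp add: domino_tops_def)
next
  case (snoc t T)
  then show ?case by (auto simp: domino_tops_append split: if_splits)
qed

lemma tiling_rank_append_1: "tiling_rank (T @ [1]) = tiling_rank T"
  by (simp add: tiling_rank_eq domino_tops_append)

lemma tiling_rank_append_2: "tiling_rank (T @ [2]) = tiling_rank T + fib (sum_list T + 1)"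
proof -
  have "finite (domino_tops T)"
    using domino_tops_le by (meson finite_nat_set_iff_bounded_le)
  moreover have "sum_list T + 2 \<notin> domino_tops T"
    using domino_tops_le by fastforce
  ultimately show ?thesis
    by (simp add: tiling_rank_eq domino_tops_append)
qed

lemma sum_tiling_rank: "(\<Sum>T\<in>fib_tilings m. q_var ^ tiling_rank T) = q_int (int (fib m))"
proof (induction m rule: fib.induct)
  case 1
  then show ?case by (simp add: fib_tilings_0)
next
  case 2
  have "tiling_rank [1] = 0"
    using tiling_rank_append_1[of "[]"] by (simp add: tiling_rank_def)
  then show ?case by (simp add: fib_tilings_1)
next
  case (3 m)
  have "(\<Sum>T\<in>fib_tilings (Suc (Suc m)). q_var ^ tiling_rank T) =
      (\<Sum>T\<in>fib_tilings (Suc m). q_var ^ tiling_rank (T @ [1])) +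
      (\<Sum>T\<in>fib_tilings m. q_var ^ tiling_rank (T @ [2]))"
    unfolding fib_tilings_Suc_Suc
    by (subst sum.union_disjoint)
      (auto simp: finite_fib_tilings sum.reindex inj_on_def)
  \<comment> \<open>Every tiling below the top domino has height \<open>m\<close>, so that domino
    adds the same amount to each rank and a power of \<open>q_var\<close> factors out.\<close>
  also have "(\<Sum>T\<in>fib_tilings m. q_var ^ tiling_rank (T @ [2])) =
      q_var ^ fib (Suc m) * (\<Sum>T\<in>fib_tilings m. q_var ^ tiling_rank T)"
    unfolding sum_distrib_left
    by (intro sum.cong) (auto simp: tiling_rank_append_2 power_add fib_tilings_def)
  finally show ?case
    using 3 q_int_add[of "fib (Suc m)" "int (fib m)"] by (simp add: tiling_rank_append_1[simplified])
qed

section \<open>Placements and weights when a column is added\<close>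

lemma placements_0: "placements n b 0 = {[]}"
  by (auto simp: placements_def)

text \<open>The cells available to the \<open>s\<close>-th tiling depend only on \<open>s\<close>
  and its column, so a later tiling leaves the earlier ones unaffected.\<close>

lemma placements_snoc:
  "P @ [(i, T)] \<in> placements n b (Suc k) \<longleftrightarrow>
     i \<in> {1..n} \<and> P \<in> placements (i - 1) b k \<and> T \<in> fib_tilings (b (i - Suc k + 1))"
proof (cases "length P = k")
  case True
  have old: "tiling_of (P @ [(i, T)]) s = tiling_of P s"
      "uncancelled b (P @ [(i, T)]) s = uncancelled b P s" if "s \<in> {1..k}" for s
  proof -
    have "s - 1 < length P"
      using that True by auto
    then show "tiling_of (P @ [(i, T)]) s = tiling_of P s"
        "uncancelled b (P @ [(i, T)]) s = uncancelled b P s"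
      by (auto simp: tiling_of_def uncancelled_def column_of_def nth_append)
  qed
  have new: "tiling_of (P @ [(i, T)]) (Suc k) = T"
      "uncancelled b (P @ [(i, T)]) (Suc k) = b (i - Suc k + 1)"
    using True by (auto simp: tiling_of_def uncancelled_def column_of_def nth_append)
  have "{1..Suc k} = insert (Suc k) {1..k}"
    by auto
  then have "(\<forall>s\<in>{1..Suc k}. tiling_of (P @ [(i, T)]) s \<in> fib_tilings (uncancelled b (P @ [(i, T)]) s))
      \<longleftrightarrow> T \<in> fib_tilings (b (i - Suc k + 1)) \<and>
        (\<forall>s\<in>{1..k}. tiling_of P s \<in> fib_tilings (uncancelled b P s))"
    using old new by simp
  moreover have "sorted_wrt (<) (map fst (P @ [(i, T)])) \<and> set (map fst (P @ [(i, T)])) \<subseteq> {1..n}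
      \<longleftrightarrow> i \<in> {1..n} \<and> sorted_wrt (<) (map fst P) \<and> set (map fst P) \<subseteq> {1..i - 1}"
    by (force simp: sorted_wrt_append)
  ultimately show ?thesis
    using True unfolding placements_def by auto
qed (simp add: placements_def)

lemma placements_Suc_Suc:
  "placements (Suc n) b (Suc k) = placements n b (Suc k) \<union>
     (\<lambda>(P, T). P @ [(Suc n, T)]) ` (placements n b k \<times> fib_tilings (b (n - k + 1)))"
    (is "?L = ?R")
proof (intro set_eqI)
  fix Q :: "(nat \<times> nat list) list"
  show "Q \<in> ?L \<longleftrightarrow> Q \<in> ?R"
  proof (cases Q rule: rev_exhaust)
    case Nil
    then show ?thesis by (auto simp: placements_def)
  next
    case (snoc P p)
    obtain i T where p: "p = (i, T)"
      by fastforce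
    have image: "Q \<in> (\<lambda>(P, T). P @ [(Suc n, T)]) ` (placements n b k \<times> fib_tilings (b (n - k + 1)))
        \<longleftrightarrow> i = Suc n \<and> P \<in> placements n b k \<and> T \<in> fib_tilings (b (n - k + 1))"
      using snoc p by force
    \<comment> \<open>By \<open>placements_snoc\<close> the two boards differ only in the bound on
      the last tiled column \<open>i\<close>, hence only at \<open>i = Suc n\<close>.\<close>
    show ?thesis
      unfolding Un_iff image unfolding snoc p placements_snoc by (cases "i = Suc n") auto
  qed
qed

lemma placements_columns_le: "P \<in> placements n b k \<Longrightarrow> p \<in> set P \<Longrightarrow> fst p \<le> n"
  by (auto simp: placements_def)

lemma placements_eq_empty: "n < k \<Longrightarrow> placements n b k = {}"
proof (induction n arbitrary: k)
  case 0
  then show ?case by (auto simp: placements_def)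
next
  case (Suc n)
  then obtain l where "k = Suc l" "n < l"
    by (cases k) auto
  with Suc.IH show ?case by (simp add: placements_Suc_Suc)
qed

text \<open>Cancellation leaves the untiled columns with an initial segment of the heights, so the
  extra factor comes from \<open>b (Suc n - length P)\<close> and not from
  \<open>b (Suc n)\<close>.\<close>

lemma placement_weight_Suc:
  assumes "length P \<le> n"
  shows "placement_weight (Suc n) b P =
    q_var ^ fib (b (Suc n - length P)) * placement_weight n b P"
  using assms by (simp add: placement_weight_def Suc_diff_le power_add)

text \<open>Board and placement both grow by one, so the number of untiled columns is
  unchanged.\<close>

lemma placement_weight_snoc:
  "placement_weight (Suc n) b (P @ [(i, T)]) = q_var ^ tiling_rank T * placement_weight n b P"
proof -
  have "(\<Sum>s=1..length P. tiling_rank (tiling_of (P @ [(i, T)]) s)) =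
      (\<Sum>s=1..length P. tiling_rank (tiling_of P s))"
    by (intro sum.cong) (auto simp: tiling_of_def nth_append)
  moreover have "tiling_of (P @ [(i, T)]) (Suc (length P)) = T"
    by (simp add: tiling_of_def)
  ultimately show ?thesis
    by (simp add: placement_weight_def power_add)
qed

section \<open>The recurrence for \<open>RT\<close> and the product formula\<close>

lemma RT_eq_0: "n < k \<Longrightarrow> RT n b k = 0"
  by (simp add: RT_def placements_eq_empty)

lemma RT_Suc_0: "RT (Suc n) b 0 = q_var ^ fib (b (Suc n)) * RT n b 0"
  by (simp add: RT_def placements_0 placement_weight_Suc)

lemma RT_Suc_Suc:
  "RT (Suc n) b (Suc k) =
     q_var ^ fib (b (n - k)) * RT n b (Suc k) + q_int (int (fib (b (n - k + 1)))) * RT n b k"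
proof -
  let ?A = "placements n b (Suc k)"
  let ?C = "placements n b k \<times> fib_tilings (b (n - k + 1))"
  let ?f = "\<lambda>(P, T). P @ [(Suc n, T)]"
  have disj: "?A \<inter> ?f ` ?C = {}"
    using placements_columns_le by fastforce
  have inj: "inj_on ?f ?C"
    by (auto simp: inj_on_def)
  have "RT (Suc n) b (Suc k) =
      (\<Sum>P\<in>?A. placement_weight (Suc n) b P) + (\<Sum>P\<in>?f ` ?C. placement_weight (Suc n) b P)"
    unfolding RT_def placements_Suc_Suc using disj
    by (intro sum.union_disjoint) (auto simp: finite_placements finite_fib_tilings)
  also have "(\<Sum>P\<in>?A. placement_weight (Suc n) b P) = q_var ^ fib (b (n - k)) * RT n b (Suc k)"
  proof (cases "Suc k \<le> n")
    case True
    then show ?thesis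
      unfolding RT_def sum_distrib_left
      by (intro sum.cong) (auto simp: placements_def placement_weight_Suc)
  next
    \<comment> \<open>Here \<open>b (n - k)\<close> is \<open>b 0\<close>, which is not a column
      height, but it is multiplied by a vanishing \<open>RT\<close>.\<close>
    case False
    then show ?thesis by (simp add: RT_def placements_eq_empty)
  qed
  also have "(\<Sum>P\<in>?f ` ?C. placement_weight (Suc n) b P) =
      (\<Sum>(P, T)\<in>?C. placement_weight n b P * q_var ^ tiling_rank T)"
    unfolding sum.reindex[OF inj] by (intro sum.cong) (auto simp: placement_weight_snoc)
  also have "\<dots> = q_int (int (fib (b (n - k + 1)))) * RT n b k"
    unfolding sum_tiling_rank[symmetric] RT_def
    by (subst mult.commute) (simp only: sum_product sum.cartesian_product)
  finally show ?thesis .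
qed

lemma q_int_power_eq:
  "q_int x ^ n = (\<Sum>k=0..n. RT n b (n - k) * (\<Prod>i=1..k. q_int (x - int (fib (b i)))))"
proof (induction n)
  case 0
  show ?case by (simp add: RT_def placements_0 placement_weight_def)
next
  case (Suc n)
  let ?p = "\<lambda>k. \<Prod>i=1..k. q_int (x - int (fib (b i)))"
  let ?c = "\<lambda>k. fib (b k)"
  have split: "q_int x * ?p k = q_int (int (?c (Suc k))) * ?p k + q_var ^ ?c (Suc k) * ?p (Suc k)" for k
    using q_int_add[of "?c (Suc k)" "x - int (?c (Suc k))"] by (simp add: algebra_simps)
  \<comment> \<open>At \<open>k = 0\<close> the suppressed term contains
    \<open>RT n b (Suc n) = 0\<close>. At \<open>k = Suc n\<close> the guard matters:
    \<open>n - k\<close> truncates to 0 and would bring in a spurious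
    \<open>RT n b 0\<close>.\<close>
  have RT_rec: "RT (Suc n) b (Suc n - k) =
      (if k = 0 then 0 else q_var ^ ?c k * RT n b (Suc n - k)) +
      (if k = Suc n then 0 else q_int (int (?c (Suc k))) * RT n b (n - k))"
    if "k \<le> Suc n" for k
  proof (cases "k = Suc n")
    case True
    then show ?thesis by (simp add: RT_Suc_0)
  next
    case False
    with that have "Suc n - k = Suc (n - k)" "n - (n - k) = k"
      by auto
    then show ?thesis
      using False RT_Suc_Suc[of n b "n - k"] by (auto simp: RT_eq_0)
  qed
  have "q_int x ^ Suc n = (\<Sum>k=0..n. RT n b (n - k) * (q_int x * ?p k))"
    by (simp add: Suc sum_distrib_left mult.left_commute)
  also have "\<dots> = (\<Sum>k=0..n. q_int (int (?c (Suc k))) * RT n b (n - k) * ?p k) +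
      (\<Sum>k=0..n. q_var ^ ?c (Suc k) * RT n b (n - k) * ?p (Suc k))"
    unfolding split by (simp only: sum.distrib[symmetric] algebra_simps)
  \<comment> \<open>The second sum is shifted by one index so that both collect the coefficient of
    the same product, as in \<open>RT_rec\<close>.\<close>
  also have "\<dots> = (\<Sum>k=0..Suc n. (if k = Suc n then 0 else q_int (int (?c (Suc k))) * RT n b (n - k)) * ?p k) +
      (\<Sum>k=0..Suc n. (if k = 0 then 0 else q_var ^ ?c k * RT n b (Suc n - k)) * ?p k)"
  proof (intro arg_cong2[where f = "(+)"])
    show "(\<Sum>k=0..n. q_var ^ ?c (Suc k) * RT n b (n - k) * ?p (Suc k)) =
        (\<Sum>k=0..Suc n. (if k = 0 then 0 else q_var ^ ?c k * RT n b (Suc n - k)) * ?p k)"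
      unfolding sum.atLeast0_atMost_Suc_shift by simp
  qed simp
  also have "\<dots> = (\<Sum>k=0..Suc n. RT (Suc n) b (Suc n - k) * ?p k)"
    unfolding sum.distrib[symmetric]
    by (intro sum.cong) (simp_all only: RT_rec atLeastAtMost_iff distrib_right add.commute)
  finally show ?case .
qed

theorem theorem9:
  fixes n :: nat and b :: "nat \<Rightarrow> nat" and x :: int
  assumes "n \<ge> 1"
    and "ferrers_board n b"
    and "b n > 0"
    and "x \<ge> int (b n)"
  shows "q_int x ^ n =
    (\<Sum>k=0..n. RT n b (n - k) * (\<Prod>i=1..k. q_int (x - int (fib (b i)))))"
  by (rule q_int_power_eq)

end
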